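(* For every real $q$ with $0<q\le q_*:=\widetilde q^{\,1/4}\approx0.7457224107$ and either choice of sign, all zeros of the partial theta function $$\Theta_0(z;\pm iq)=\sum_{n=0}^\infty(\pm iq)^{\frac{n(n-1)}2}z^n$$ are simple, and distinct zeros have distinct absolute values.
   Context: $\Theta_0(z;q)=\sum_{n=0}^\infty q^{n(n-1)/2}z^n$ for $|q|<1$. The constant $\widetilde q\approx0.3092493386$ is the largest number in $(0,1)$ such that $\Theta_0(z;q)$ has only negative zeros for all $0<q\le\widetilde q$ (its existence and numerical value are known from the work of Kostov and Shapiro). *)

theory Defs
  imports "HOL-Complex_Analysis.Complex_Analysis"
begin

definition partial_theta :: "complex \<Rightarrow> complex \<Rightarrow> complex"
  where "partial_theta z q = (\<Sum>n. q ^ (n * (n - 1) div 2) * z ^ n)"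

definition only_negative_zeros :: "real \<Rightarrow> bool"
  where "only_negative_zeros q \<longleftrightarrow>
    (\<forall>z. partial_theta z (complex_of_real q) = 0 \<longrightarrow> z \<in> \<real> \<and> Re z < 0)"

definition negative_zeros_bounds :: "real set"
  where "negative_zeros_bounds =
    {r \<in> {0<..<1}. \<forall>q. 0 < q \<and> q \<le> r \<longrightarrow> only_negative_zeros q}"

text \<open>
  The constant written as q with a tilde (about 0.3092493386) is the greatest element of this
  set. It is characterised by a predicate, which determines it uniquely; that the greatest
  element exists is a result of Kostov and Shapiro.
\<close>

definition is_q_tilde :: "real \<Rightarrow> bool"
  where "is_q_tilde r \<longleftrightarrow>
    r \<in> negative_zeros_bounds \<and> (\<forall>s\<in>negative_zeros_bounds. s \<le> r)"

end

theory Submission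
  imports Defs
begin

text \<open>
  Splitting the series into even and odd n gives \<Theta>(z; p) = F(v) + z F(- q^2 v), where
  v = p z^2 and F is the partial theta function with parameter p^4 = q^4, whose zeros are all
  negative. F has order less than 1, so it is a genus zero product of factors 1 + w / a with
  a > 0; hence Im (w F'(w) / F(w)) has the sign of Im w, and on a circle |F| increases strictly
  with the real part. At a zero, z = - F(v) / F(- q^2 v). When |z| is given, this fixes Re v, so v is
  determined up to conjugation, and conjugation is excluded because p is imaginary. At a double
  zero the logarithmic derivatives of F at v and at - q^2 v would have equal imaginary parts,
  although these have opposite signs.
\<close>

subsection \<open>Logarithmic derivatives of zero-free functions\<close>

text \<open>The map u / (2 A - u) sends the half-plane Re u < A into the unit disc and fixes 0, so
  the Schwarz lemma applies to g after rescaling. Solving for \<open>g z\<close>, the term |g z| on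
  the right carries a factor of at most 1/2 and is absorbed.\<close>

lemma Borel_Caratheodory_half:
  fixes g :: "complex \<Rightarrow> complex"
  assumes g: "g holomorphic_on ball 0 R" "g 0 = 0"
    and A: "\<And>z. norm z < R \<Longrightarrow> Re (g z) < A"
    and z: "norm z \<le> R / 2" and R: "R > 0"
  shows "norm (g z) \<le> 4 * A * norm z / R"
proof -
  have A0: "A > 0" using A[of 0] g(2) R by simp
  \<comment> \<open>2 A is the mirror image of 0 in the line Re u = A, so points to the left of the
    line are nearer to 0.\<close>
  have lt: "norm u < norm (2 * of_real A - u)" if "Re u < A" for u
  proof -
    have "(norm u)\<^sup>2 < (norm (2 * of_real A - u))\<^sup>2"
      unfolding cmod_power2 using mult_strict_left_mono[OF that A0]
      by (simp add: power2_eq_square algebra_simps)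
    thus ?thesis by (simp add: power_less_imp_less_base)
  qed
  define h where "h u = g (of_real R * u) / (2 * of_real A - g (of_real R * u))" for u
  have in_ball: "norm (of_real R * u) < R" if "norm u < 1" for u :: complex
    using that R by (simp add: norm_mult)
  have nz: "2 * of_real A - g (of_real R * u) \<noteq> 0" if "norm u < 1" for u
    using lt[OF A[OF in_ball[OF that]]] by auto
  have "(\<lambda>u. g (of_real R * u)) holomorphic_on ball 0 1"
    using in_ball by (intro holomorphic_on_compose_gen[OF _ g(1), unfolded o_def] holomorphic_intros)
      auto
  hence hol: "h holomorphic_on ball 0 1"
    unfolding h_def using nz by (intro holomorphic_intros) auto
  have h1: "norm (h u) < 1" if "norm u < 1" for u
    using lt[OF A[OF in_ball[OF that]]] nz[OF that] by (simp add: h_def norm_divide divide_simps)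
  define u where "u = z / of_real R"
  have u: "norm u \<le> 1/2" using z R by (simp add: u_def norm_divide field_simps)
  have Ru: "of_real R * u = z" using R by (simp add: u_def)
  have "norm (h u) \<le> norm u"
    using Schwarz_Lemma(1)[OF hol _ h1, of u] u g(2) by (simp add: h_def)
  hence "norm (g z) \<le> norm u * norm (2 * of_real A - g z)"
    using nz[of u] u by (simp add: h_def Ru norm_divide divide_simps)
  also have "\<dots> \<le> norm u * (2 * A + norm (g z))"
    using norm_triangle_ineq4[of "2 * of_real A" "g z"] A0
    by (intro mult_left_mono) (auto simp: norm_mult)
  also have "\<dots> \<le> norm u * (2 * A) + 1/2 * norm (g z)"
    using mult_right_mono[OF u, of "norm (g z)"] by (simp add: algebra_simps)
  finally have "norm (g z) \<le> 4 * A * norm u" by (simp add: algebra_simps)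
  thus ?thesis using R by (simp add: u_def norm_divide)
qed

text \<open>G has a holomorphic logarithm g on the disc, and G'/G = g'. The bound on |G| bounds Re g
  from above, Borel-Caratheodory turns this into a bound on |g|, and Cauchy's inequality on the
  circle of radius |w| + 1 about w bounds g'(w). The condition on R keeps this circle within radius
  R / 2.\<close>

lemma logarithmic_derivative_bound:
  fixes G :: "complex \<Rightarrow> complex"
  assumes G: "G holomorphic_on ball 0 R" "G 0 = 1"
    and nz: "\<And>z. norm z < R \<Longrightarrow> G z \<noteq> 0"
    and A: "\<And>z. norm z < R \<Longrightarrow> norm (G z) < exp A"
    and w: "4 * norm w + 2 \<le> R"
  shows "norm (deriv G w / G w) \<le> 8 * A / R"
proof -
  have R: "R > 0" using w norm_ge_zero[of w] by linarith
  have A0: "A > 0" using A[of 0] G R by simp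
  have "simply_connected (ball (0::complex) R)" by (simp add: convex_imp_simply_connected)
  then obtain g0 where g0: "g0 holomorphic_on ball 0 R" "\<And>z. z \<in> ball 0 R \<Longrightarrow> G z = exp (g0 z)"
    using G nz unfolding simply_connected_eq_holomorphic_log[OF open_ball] by (metis mem_ball_0)
  \<comment> \<open>Normalised to vanish at 0; the shift is harmless because
    \<open>exp (g0 0) = G 0 = 1\<close>.\<close>
  define g where "g z = g0 z - g0 0" for z
  have g: "g holomorphic_on ball 0 R" unfolding g_def using g0(1) by (intro holomorphic_intros)
  have "exp (g0 0) = 1" using g0(2)[of 0] G R by simp
  hence Gg: "G z = exp (g z)" if "norm z < R" for z
    using g0(2)[of z] that by (simp add: g_def exp_diff)
  have Re: "Re (g z) < A" if "norm z < R" for z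
    using A[OF that] that by (simp add: Gg)
  have bd: "norm (g z) \<le> 4 * A * norm z / R" if "norm z \<le> R / 2" for z
    using Borel_Caratheodory_half[OF g _ Re that R] by (simp add: g_def)
  have sub: "cball w (norm w + 1) \<subseteq> ball 0 R"
  proof
    fix z assume "z \<in> cball w (norm w + 1)"
    hence "norm (z - w) \<le> norm w + 1" by (simp add: dist_norm norm_minus_commute)
    hence "norm z \<le> 2 * norm w + 1" using norm_triangle_sub[of z w] by linarith
    also have "\<dots> < R" using w by (smt (verit) norm_ge_zero)
    finally show "z \<in> ball 0 R" by simp
  qed
  have "norm ((deriv ^^ 1) g w) \<le> fact 1 * (4 * A * (2 * norm w + 1) / R) / (norm w + 1) ^ 1"
  proof (rule Cauchy_inequality)
    show "g holomorphic_on ball w (norm w + 1)"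
      using g sub ball_subset_cball by (meson holomorphic_on_subset order_trans)
    show "continuous_on (cball w (norm w + 1)) g"
      using g sub holomorphic_on_imp_continuous_on holomorphic_on_subset by blast
    show "0 < norm w + 1" by (smt (verit) norm_ge_zero)
    fix x assume "norm (w - x) = norm w + 1"
    hence x: "norm x \<le> 2 * norm w + 1" using norm_triangle_sub[of x w]
      by (simp add: norm_minus_commute)
    have "norm (g x) \<le> 4 * A * norm x / R" using bd x w by simp
    also have "\<dots> \<le> 4 * A * (2 * norm w + 1) / R"
      using x A0 R by (intro divide_right_mono mult_left_mono) auto
    finally show "norm (g x) \<le> 4 * A * (2 * norm w + 1) / R" .
  qed
  also have "\<dots> \<le> 8 * A / R"
  proof -
    have "4 * A * (2 * norm w + 1) \<le> 8 * A * (norm w + 1)" using A0 by (simp add: algebra_simps)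
    moreover have "norm w + 1 > 0" by (smt (verit) norm_ge_zero)
    ultimately show ?thesis using R by (simp add: divide_simps)
  qed
  finally have 1: "norm (deriv g w) \<le> 8 * A / R" by simp
  have wR: "w \<in> ball 0 R" using w norm_ge_zero[of w] by (simp, linarith)
  have "(G has_field_derivative exp (g w) * deriv g w) (at w)"
  proof (rule has_field_derivative_transform_within_open)
    show "((\<lambda>z. exp (g z)) has_field_derivative exp (g w) * deriv g w) (at w)"
      using holomorphic_derivI[OF g open_ball wR] by (auto intro!: derivative_eq_intros)
    show "open (ball (0::complex) R)" "w \<in> ball 0 R" using wR by auto
  qed (auto simp: Gg)
  hence "deriv G w = G w * deriv g w" using wR by (simp add: DERIV_imp_deriv Gg)
  thus ?thesis using 1 nz wR by simp
qed

subsection \<open>Entire functions of small growth with negative zeros\<close>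

lemma divide_out_zero:
  fixes f :: "complex \<Rightarrow> complex"
  assumes "f holomorphic_on UNIV" "f b = 0" "b \<noteq> 0"
  shows "\<exists>h. h holomorphic_on UNIV \<and> (\<forall>z. f z = (1 - z / b) * h z)"
proof (intro exI conjI allI)
  \<comment> \<open>The difference quotient with its removable singularity filled in; the factor -b
    turns z - b into 1 - z / b.\<close>
  define h where "h z = - b * (if z = b then deriv f b else (f z - f b) / (z - b))" for z
  show "h holomorphic_on UNIV"
    unfolding h_def by (intro holomorphic_intros pole_lemma_open assms open_UNIV)
  show "f z = (1 - z / b) * h z" for z
    using assms by (cases "z = b") (auto simp: h_def field_simps)
qed

text \<open>A list can repeat an entry, so multiple zeros are recorded with multiplicity.\<close>

definition neg_root_prod :: "real list \<Rightarrow> complex \<Rightarrow> complex" where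
  "neg_root_prod as z = (\<Prod>a\<leftarrow>as. 1 + z / of_real a)"

lemma neg_root_prod_simps [simp]:
  "neg_root_prod [] z = 1"
  "neg_root_prod (a # as) z = (1 + z / of_real a) * neg_root_prod as z"
  "neg_root_prod as 0 = 1"
  by (simp_all add: neg_root_prod_def) (induction as; simp)

lemma neg_root_prod_eq_0_iff:
  "\<forall>a\<in>set as. a > 0 \<Longrightarrow> neg_root_prod as z = 0 \<longleftrightarrow> (\<exists>a\<in>set as. z = - of_real a)"
proof (induction as)
  case (Cons a as)
  have "1 + z / of_real a = 0 \<longleftrightarrow> z = - of_real a"
    using Cons.prems by (simp add: divide_simps) (metis add.commute add_eq_0_iff)
  thus ?case using Cons by simp
qed simp

text \<open>At radius 3 R each |z / a| is at least 3, so every factor has modulus at least 2. The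
  exponential gain limits the number of zeros in the disc of radius R.\<close>

lemma norm_neg_root_prod_ge:
  assumes "\<forall>a\<in>set as. 0 < a \<and> a \<le> R" "norm z = 3 * R"
  shows "norm (neg_root_prod as z) \<ge> 2 ^ length as"
  using assms(1)
proof (induction as)
  case (Cons a as)
  have "3 \<le> norm (z / of_real a)" using Cons.prems assms(2) by (simp add: norm_divide field_simps)
  hence "2 \<le> norm (1 + z / of_real a)"
    using norm_diff_ineq[of "z / of_real a" 1] by (simp add: add.commute)
  thus ?case using Cons by (simp add: norm_mult) (intro mult_mono; simp)
qed simp

lemma neg_root_prod_has_field_derivative:
  assumes "\<forall>a\<in>set as. a > 0" "neg_root_prod as z \<noteq> 0"
  shows "(neg_root_prod as has_field_derivative
      neg_root_prod as z * (\<Sum>a\<leftarrow>as. 1 / (z + of_real a))) (at z)"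
  using assms
proof (induction as)
  case Nil
  have "neg_root_prod [] = (\<lambda>_. 1)" by (rule ext) simp
  thus ?case by simp
next
  case (Cons a as)
  have *: "neg_root_prod (a # as) = (\<lambda>z. (1 + z / of_real a) * neg_root_prod as z)"
    by (rule ext) simp
  have a: "a > 0" "1 + z / of_real a \<noteq> 0" "z + of_real a \<noteq> 0"
    using Cons.prems by (auto simp: divide_simps add.commute)
  have IH: "(neg_root_prod as has_field_derivative
      neg_root_prod as z * (\<Sum>a\<leftarrow>as. 1 / (z + of_real a))) (at z)"
    using Cons by auto
  have "((\<lambda>z. 1 + z / of_real a) has_field_derivative 1 / of_real a) (at z)"
    using a by (auto intro!: derivative_eq_intros)
  from DERIV_mult[OF this IH] show ?case
    unfolding * by (rule DERIV_cong) (use a in \<open>auto simp: divide_simps\<close>, simp add: algebra_simps)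
qed

text \<open>The maximum modulus principle carries the bound for the quotient from the circle of
  radius 3 R to the whole disc. At z = 0 it becomes a Jensen-type count of zeros.\<close>

lemma neg_root_prod_quotient_bound:
  assumes G: "G holomorphic_on UNIV" and as: "\<forall>a\<in>set as. 0 < a \<and> a \<le> R" and R: "R > 0"
    and B: "\<And>z. norm z = 3 * R \<Longrightarrow> norm (neg_root_prod as z * G z) \<le> B"
    and z: "norm z \<le> 3 * R"
  shows "norm (G z) * 2 ^ length as \<le> B"
proof -
  have "norm (G z) \<le> B / 2 ^ length as"
  proof (rule maximum_modulus_frontier[of G "cball 0 (3 * R)"])
    show "G holomorphic_on interior (cball 0 (3 * R))" "continuous_on (closure (cball 0 (3 * R))) G"
      using G holomorphic_on_imp_continuous_on holomorphic_on_subset by blast+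
    fix u assume "u \<in> frontier (cball (0::complex) (3 * R))"
    hence u: "norm u = 3 * R" using R by simp
    have "norm (G u) * 2 ^ length as \<le> norm (G u) * norm (neg_root_prod as u)"
      by (intro mult_left_mono norm_neg_root_prod_ge[OF as u]) auto
    also have "\<dots> \<le> B" using B[OF u] by (simp add: norm_mult mult.commute)
    finally show "norm (G u) \<le> B / 2 ^ length as" by (simp add: field_simps)
  qed (use z in auto)
  thus ?thesis by (simp add: field_simps)
qed

text \<open>The assumption \<open>growth\<close> is minimal exponential type. It stands in for the
  genus zero product, which is never formed; finite products with a controlled error are used
  instead.\<close>

locale entire_negative_zeros =
  fixes f :: "complex \<Rightarrow> complex"
  assumes hol: "f holomorphic_on UNIV" and f_0: "f 0 = 1"
    and zeros: "f z = 0 \<Longrightarrow> z \<in> \<real> \<and> Re z < 0"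
    and growth: "e > 0 \<Longrightarrow> \<exists>C. \<forall>z. norm (f z) \<le> C * exp (e * norm z)"
begin

lemma f_nonzero: "\<not> (Im z = 0 \<and> Re z < 0) \<Longrightarrow> f z \<noteq> 0"
  using zeros[of z] by (auto simp: complex_is_Real_iff)

text \<open>A list of maximal length is split off. Lengths are bounded because the quotient is 1 at
  0, so 2 to the length is at most the bound on the circle of radius 3 R. A further zero of the
  quotient in the disc would be a negative zero of f and would extend the list.\<close>

lemma factor_in_ball:
  assumes R: "R > 0"
  obtains as G where "\<forall>a\<in>set as. 0 < a \<and> a \<le> R" "G holomorphic_on UNIV"
    "\<And>z. f z = neg_root_prod as z * G z" "\<And>z. norm z \<le> R \<Longrightarrow> G z \<noteq> 0"
proof -
  define P where "P as \<longleftrightarrow> (\<forall>a\<in>set as. 0 < a \<and> a \<le> R) \<and>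
    (\<exists>G. G holomorphic_on UNIV \<and> (\<forall>z. f z = neg_root_prod as z * G z))" for as
  obtain C where C: "\<And>z. norm (f z) \<le> C * exp (1 * norm z)" using growth[of 1] by auto
  define B where "B = C * exp (3 * R)"
  obtain m :: nat where m: "B < 2 ^ m" using real_arch_pow[of 2 B] by auto
  have bdd: "length as < m" if P: "P as" for as
  proof -
    obtain G where as: "\<forall>a\<in>set as. 0 < a \<and> a \<le> R" and G: "G holomorphic_on UNIV"
      "\<And>z. f z = neg_root_prod as z * G z" using P unfolding P_def by blast
    have "norm (G 0) * 2 ^ length as \<le> B"
    proof (rule neg_root_prod_quotient_bound[OF G(1) as R])
      fix z :: complex assume "norm z = 3 * R"
      thus "norm (neg_root_prod as z * G z) \<le> B" using C[of z] by (simp add: B_def flip: G(2))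
    qed (use R in auto)
    hence "2 ^ length as \<le> B" using G(2)[of 0] f_0 by simp
    hence "(2::real) ^ length as < 2 ^ m" using m by linarith
    thus ?thesis by simp
  qed
  have "P []" using hol by (auto simp: P_def)
  hence "\<exists>as. P as \<and> (\<forall>bs. P bs \<longrightarrow> length bs \<le> length as)"
    by (rule ex_has_greatest_nat) (use bdd in blast)
  then obtain as where as: "P as" and max: "\<And>bs. P bs \<Longrightarrow> length bs \<le> length as"
    by blast
  obtain G where G: "G holomorphic_on UNIV" "\<And>z. f z = neg_root_prod as z * G z"
    using as unfolding P_def by blast
  have "G b \<noteq> 0" if b: "norm b \<le> R" for b
  proof
    assume Gb: "G b = 0"
    hence "f b = 0" using G(2) by simp
    from zeros[OF this] have b': "b = - of_real (- Re b)" "Re b < 0" by (auto elim!: Reals_cases)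
    have bnz: "b \<noteq> 0" using b'(2) by force
    obtain H where H: "H holomorphic_on UNIV" "\<And>z. G z = (1 - z / b) * H z"
      using divide_out_zero[OF G(1) Gb bnz] by blast
    have "P (- Re b # as)"
      unfolding P_def
    proof (intro conjI exI[of _ H] allI)
      have "- Re b \<le> R" using b abs_Re_le_cmod[of b] by linarith
      thus "\<forall>a\<in>set (- Re b # as). 0 < a \<and> a \<le> R" using as b'(2) by (auto simp: P_def)
      have "1 - z / b = 1 + z / of_real (- Re b)" for z
        using b'(1) by (metis diff_conv_add_uminus divide_minus_right minus_minus)
      thus "f z = neg_root_prod (- Re b # as) z * H z" for z
        by (simp only: G(2) H(2) neg_root_prod_simps mult_ac)
    qed (rule H(1))
    from max[OF this] show False by simp
  qed
  with that[of as G] as G show thesis by (auto simp: P_def)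
qed

text \<open>After the zeros up to a large radius R are divided out, the remaining factor G is
  bounded by exp A with A = ln C + 3 d R, so G'/G is at most 8 A / R, which minimal type makes
  arbitrarily small. The parameter M forces chosen zeros into the list.\<close>

lemma log_derivative_approx:
  assumes w: "f w \<noteq> 0" and e: "e > 0"
  shows "\<exists>as. (\<forall>a\<in>set as. 0 < a \<and> f (- of_real a) = 0) \<and>
    (\<forall>a\<le>M. f (- of_real a) = 0 \<longrightarrow> a \<in> set as) \<and>
    norm (deriv f w / f w - (\<Sum>a\<leftarrow>as. 1 / (w + of_real a))) \<le> e"
proof -
  \<comment> \<open>The final bound is 8 A / R = 8 ln C / R + 24 d. This choice makes 24 d = e / 2,
    and R is chosen below so that the other term is also at most e / 2.\<close>
  define d where "d = e / 48"
  have d: "d > 0" using e by (simp add: d_def)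
  obtain C0 where C0: "\<And>z. norm (f z) \<le> C0 * exp (d * norm z)" using growth[OF d] by auto
  \<comment> \<open>The extra 1 yields the strict bound |G| < exp A that
    \<open>logarithmic_derivative_bound\<close> requires.\<close>
  define C where "C = max 1 C0 + 1"
  have C1: "C > 1" by (simp add: C_def)
  have C: "norm (f z) \<le> (C - 1) * exp (d * norm z)" for z
    using C0[of z] by (rule order_trans) (simp add: C_def)
  define R where "R = max (max 1 M) (max (4 * norm w + 2) (16 * ln C / e))"
  have R: "R > 0" "M \<le> R" "4 * norm w + 2 \<le> R" "16 * ln C / e \<le> R" by (auto simp: R_def)
  obtain as G where as: "\<forall>a\<in>set as. 0 < a \<and> a \<le> R" and G: "G holomorphic_on UNIV"
    "\<And>z. f z = neg_root_prod as z * G z" "\<And>z. norm z \<le> R \<Longrightarrow> G z \<noteq> 0"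
    using factor_in_ball[OF R(1)] by blast
  have G0: "G 0 = 1" using G(2)[of 0] f_0 by simp
  define A where "A = ln C + d * (3 * R)"
  have bd: "norm (G z) < exp A" if "norm z < R" for z
  proof -
    have "norm (G z) * 1 \<le> norm (G z) * 2 ^ length as" by (intro mult_left_mono) auto
    also have "\<dots> \<le> (C - 1) * exp (d * (3 * R))"
    proof (rule neg_root_prod_quotient_bound[OF G(1) as R(1)])
      fix z :: complex assume "norm z = 3 * R"
      thus "norm (neg_root_prod as z * G z) \<le> (C - 1) * exp (d * (3 * R))"
        using C[of z] by (simp flip: G(2))
    qed (use that R(1) in auto)
    also have "\<dots> < C * exp (d * (3 * R))" by simp
    also have "\<dots> = exp A" using C1 by (simp add: A_def exp_add)
    finally show ?thesis by simp
  qed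
  have "norm (deriv G w / G w) \<le> 8 * A / R"
    by (rule logarithmic_derivative_bound) (use G G0 bd R in \<open>auto intro: holomorphic_on_subset\<close>)
  also have "\<dots> = 8 * ln C / R + e / 2" using R(1) by (simp add: A_def d_def field_simps)
  also have "8 * ln C / R \<le> e / 2" using R(1,4) e by (simp add: field_simps)
  finally have small: "norm (deriv G w / G w) \<le> e" by simp
  have nz: "neg_root_prod as w \<noteq> 0" "G w \<noteq> 0" using w G(2) by auto
  have "f = (\<lambda>z. neg_root_prod as z * G z)" using G(2) by auto
  moreover have "((\<lambda>z. neg_root_prod as z * G z) has_field_derivative
      neg_root_prod as w * (\<Sum>a\<leftarrow>as. 1 / (w + of_real a)) * G w
        + deriv G w * neg_root_prod as w) (at w)"
    using as by (intro DERIV_mult neg_root_prod_has_field_derivative nz)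
      (auto intro: holomorphic_derivI[OF G(1)])
  ultimately have "deriv f w = neg_root_prod as w * (\<Sum>a\<leftarrow>as. 1 / (w + of_real a)) * G w
      + deriv G w * neg_root_prod as w" by (simp add: DERIV_imp_deriv)
  hence *: "deriv f w / f w - (\<Sum>a\<leftarrow>as. 1 / (w + of_real a)) = deriv G w / G w"
    using nz by (simp add: G(2) divide_simps)
  have 1: "a \<in> set as" if "f (- of_real a) = 0" "a \<le> M" for a
  proof -
    have "a > 0" using zeros[OF that(1)] by simp
    hence "G (- of_real a) \<noteq> 0" using G(3)[of "- of_real a"] that(2) R(2) by simp
    hence "neg_root_prod as (- of_real a) = 0" using that(1) G(2) by auto
    thus ?thesis using as by (subst (asm) neg_root_prod_eq_0_iff) auto
  qed
  have 2: "0 < a \<and> f (- of_real a) = 0" if "a \<in> set as" for a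
  proof -
    have "neg_root_prod as (- of_real a) = 0" using as that by (subst neg_root_prod_eq_0_iff) auto
    thus ?thesis using as that by (simp add: G(2))
  qed
  have "norm (deriv f w / f w - (\<Sum>a\<leftarrow>as. 1 / (w + of_real a))) \<le> e" using small * by simp
  with 1 2 show ?thesis by blast
qed

text \<open>Without zeros every approximating list is empty, so f'/f is smaller than any e > 0. Then
  f is constant, equal to \<open>f 0 = 1\<close>.\<close>

lemma exists_zero:
  assumes "f z \<noteq> 1"
  shows "\<exists>b>0. f (- of_real b) = 0"
proof (rule ccontr)
  assume "\<not> (\<exists>b>0. f (- of_real b) = 0)"
  hence no: "f (- of_real b) \<noteq> 0" if "b > 0" for b using that by blast
  have nz: "f w \<noteq> 0" for w
  proof
    assume "f w = 0"
    moreover obtain x where "w = - of_real (- x)" "- x > 0"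
      using zeros[OF \<open>f w = 0\<close>] by (auto elim!: Reals_cases)
    ultimately show False using no[of "- x"] by simp
  qed
  have bound: "norm (deriv f w / f w) \<le> 0 + e" if e: "e > 0" for e w
  proof -
    obtain as where as: "\<forall>a\<in>set as. 0 < a \<and> f (- of_real a) = 0"
      "norm (deriv f w / f w - (\<Sum>a\<leftarrow>as. 1 / (w + of_real a))) \<le> e"
      using log_derivative_approx[OF nz[of w] e, of 0] by blast
    have "a \<notin> set as" for a using bspec[OF as(1), of a] no[of a] by auto
    hence "as = []" by (cases as) auto
    with as(2) show ?thesis by simp
  qed
  have "(f has_field_derivative 0) (at w within UNIV)" for w
  proof -
    have "norm (deriv f w / f w) \<le> 0"
    proof (rule field_le_epsilon)
      fix e :: real assume "e > 0"
      thus "norm (deriv f w / f w) \<le> 0 + e" by (rule bound)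
    qed
    hence "deriv f w = 0" using nz[of w] by simp
    thus ?thesis using holomorphic_derivI[OF hol open_UNIV, of w] by simp
  qed
  from has_field_derivative_zero_constant[OF convex_UNIV this]
  have "\<exists>c. \<forall>w\<in>UNIV. f w = c" .
  then obtain c where "\<forall>w\<in>UNIV. f w = c" ..
  hence "f z = f 0" by (simp only: UNIV_I)
  thus False using f_0 assms by metis
qed

end

section \<open>Sign of Im (w f'/f) and monotonicity of |f| on circles\<close>

lemma Im_div_add_real:
  assumes "a > 0" "Im w \<noteq> 0"
  shows "Im w * Im (w / (w + of_real a)) > 0"
proof -
  have "Im w * Im (w / (w + of_real a)) = a * (Im w)\<^sup>2 / ((Re w + a)\<^sup>2 + (Im w)\<^sup>2)"
    by (simp add: Im_divide power2_eq_square algebra_simps)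
  also have "\<dots> > 0" using assms by (intro divide_pos_pos mult_pos_pos add_nonneg_pos) auto
  finally show ?thesis .
qed

lemma member_le_sum_list_real:
  fixes t :: "'a \<Rightarrow> real"
  assumes "\<And>a. a \<in> set as \<Longrightarrow> 0 \<le> t a" "b \<in> set as"
  shows "t b \<le> (\<Sum>a\<leftarrow>as. t a)"
  using assms
proof (induction as)
  case (Cons a as)
  have "(\<Sum>a\<leftarrow>as. t a) \<ge> 0" using Cons.prems(1) by (intro sum_list_nonneg) auto
  moreover have "t a \<ge> 0" using Cons.prems(1) by simp
  moreover have "b = a \<or> t b \<le> (\<Sum>a\<leftarrow>as. t a)" using Cons by auto
  ultimately show ?case by auto
qed simp

text \<open>All summands are positive, so a single zero b gives a lower bound independent of the
  list. It therefore survives the approximation of f'/f.\<close>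

lemma Im_sum_list_ge:
  assumes "\<And>a. a \<in> set as \<Longrightarrow> 0 < a" "b \<in> set as" "Im w \<noteq> 0"
  shows "Im w * Im (w * (\<Sum>a\<leftarrow>as. 1 / (w + of_real a))) \<ge> Im w * Im (w / (w + of_real b))"
proof -
  let ?t = "\<lambda>a. Im w * Im (w / (w + of_real a))"
  have "Im w * Im (w * (\<Sum>a\<leftarrow>as. 1 / (w + of_real a))) = (\<Sum>a\<leftarrow>as. ?t a)"
    by (induction as) (simp_all add: algebra_simps)
  moreover have "?t b \<le> (\<Sum>a\<leftarrow>as. ?t a)"
    by (rule member_le_sum_list_real)
      (use assms Im_div_add_real[THEN less_imp_le] in blast)+
  ultimately show ?thesis by linarith
qed

text \<open>With u = f(z) and l = z f'(z) / f(z), this is half the derivative of |f|^2 with respect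
  to the angle.\<close>

lemma inner_i_mult: "u \<bullet> (\<i> * l * u) = - (norm u)\<^sup>2 * Im l" for u l :: complex
  unfolding cmod_power2 by (simp add: inner_complex_def power2_eq_square algebra_simps)

text \<open>Being nonconstant guarantees a zero, which makes the sign of Im (w f'/f) strict.\<close>

locale real_entire_negative_zeros = entire_negative_zeros +
  assumes real: "f (cnj z) = cnj (f z)" and nonconstant: "\<exists>z. f z \<noteq> 1"
begin

text \<open>The factor \<open>Im w\<close> treats both half-planes at once.\<close>

lemma Im_log_derivative:
  assumes w: "Im w \<noteq> 0"
  shows "Im w * Im (w * deriv f w / f w) > 0"
proof -
  obtain b where b: "b > 0" "f (- of_real b) = 0" using nonconstant exists_zero by blast
  define t where "t = Im w * Im (w / (w + of_real b))"
  have t: "t > 0" unfolding t_def by (rule Im_div_add_real[OF b(1) w])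
  have w0: "w \<noteq> 0" "f w \<noteq> 0" using w f_nonzero by auto
  \<comment> \<open>After multiplication by w and \<open>Im w\<close>, the approximation error is at
    most t / 2, half of what the zero b contributes.\<close>
  define e where "e = t / (2 * \<bar>Im w\<bar> * norm w)"
  have e: "e > 0" using t w w0 by (simp add: e_def)
  obtain as where as: "\<forall>a\<in>set as. 0 < a \<and> f (- of_real a) = 0"
    "\<forall>a\<le>b. f (- of_real a) = 0 \<longrightarrow> a \<in> set as"
    "norm (deriv f w / f w - (\<Sum>a\<leftarrow>as. 1 / (w + of_real a))) \<le> e"
    using log_derivative_approx[OF w0(2) e, of b] by blast
  define S where "S = (\<Sum>a\<leftarrow>as. 1 / (w + of_real a))"
  have S: "Im w * Im (w * S) \<ge> t"
    unfolding S_def t_def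
  proof (rule Im_sum_list_ge[OF _ _ w])
    show "b \<in> set as" using as(2) b(2) by simp
    show "0 < a" if "a \<in> set as" for a using bspec[OF as(1) that] by simp
  qed
  let ?D = "w * (deriv f w / f w - S)"
  have "\<bar>Im w * Im ?D\<bar> \<le> \<bar>Im w\<bar> * norm ?D"
    using abs_Im_le_cmod[of ?D] by (simp add: abs_mult mult_left_mono)
  also have "\<dots> \<le> \<bar>Im w\<bar> * (norm w * e)"
    unfolding norm_mult using as(3) by (intro mult_left_mono) (auto simp: S_def)
  also have "\<dots> = t / 2" using w w0 by (simp add: e_def)
  finally have "Im w * Im ?D \<ge> - (t / 2)" by simp
  moreover have "Im w * Im (w * deriv f w / f w) = Im w * Im (w * S) + Im w * Im ?D"
    by (simp only: times_divide_eq_right right_diff_distrib minus_complex.sel distrib_left)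
  ultimately show ?thesis using S t by simp
qed

text \<open>The angular derivative of |f|^2 is -2 |f|^2 Im (z f'/f), which is negative in the open
  upper half-plane.\<close>

lemma norm_cis_decreasing:
  assumes r: "r > 0" and ab: "0 \<le> \<alpha>" "\<alpha> < \<beta>" "\<beta> \<le> pi"
  shows "norm (f (of_real r * cis \<beta>)) < norm (f (of_real r * cis \<alpha>))"
proof -
  define z where "z t = of_real r * cis t" for t
  define h where "h t = f (z t) \<bullet> f (z t)" for t
  have dz: "(z has_vector_derivative \<i> * z t) (at t)" for t
    unfolding z_def has_vector_derivative_def
    by (auto intro!: derivative_eq_intros simp: fun_eq_iff scaleR_conv_of_real)
  have df: "(f has_field_derivative deriv f w) (at w)" for w
    by (rule holomorphic_derivI[OF hol open_UNIV]) auto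
  have dfz: "((\<lambda>t. f (z t)) has_vector_derivative \<i> * z t * deriv f (z t)) (at t)" for t
    using field_vector_diff_chain_at[OF dz df] by (simp add: o_def)
  have dh: "(h has_real_derivative 2 * (f (z t) \<bullet> (\<i> * z t * deriv f (z t)))) (at t)" for t
    using bounded_bilinear.has_vector_derivative[OF bounded_bilinear_inner dfz dfz, of t]
    unfolding h_def has_real_derivative_iff_has_vector_derivative
    by (simp add: inner_commute)
  have "h \<alpha> > h \<beta>"
  proof (rule DERIV_neg_imp_decreasing_open[OF ab(2)])
    show "continuous_on {\<alpha>..\<beta>} h"
      by (intro continuous_at_imp_continuous_on ballI DERIV_isCont[OF dh])
    fix t assume t: "\<alpha> < t" "t < \<beta>"
    have "Im (z t) > 0" unfolding z_def using t ab r by (simp add: sin_gt_zero)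
    hence "Im (z t * deriv f (z t) / f (z t)) > 0" (is "Im ?L > 0") and nz: "f (z t) \<noteq> 0"
      using Im_log_derivative[of "z t"] f_nonzero[of "z t"] by (auto simp: zero_less_mult_iff)
    moreover have "f (z t) \<bullet> (\<i> * z t * deriv f (z t)) = - (norm (f (z t)))\<^sup>2 * Im ?L"
    proof -
      have "z t * deriv f (z t) = ?L * f (z t)" using nz by simp
      hence "\<i> * z t * deriv f (z t) = \<i> * ?L * f (z t)" by (metis mult.assoc)
      thus ?thesis by (simp only: inner_i_mult)
    qed
    ultimately have "2 * (f (z t) \<bullet> (\<i> * z t * deriv f (z t))) < 0" by simp
    thus "\<exists>y. (h has_real_derivative y) (at t) \<and> y < 0" using dh by blast
  qed
  thus ?thesis unfolding h_def z_def dot_square_norm by (simp add: power_less_imp_less_base)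
qed

text \<open>The point on the right is w or its conjugate, and |f| agrees at conjugate points. This
  moves any w to an angle in [0, pi].\<close>

lemma norm_f_cis_arccos:
  assumes "w \<noteq> 0"
  shows "norm (f w) = norm (f (of_real (norm w) * cis (arccos (Re w / norm w))))"
proof -
  define c where "c = Re w / norm w"
  have c: "\<bar>c\<bar> \<le> 1" using assms abs_Re_le_cmod[of w] by (simp add: c_def)
  have Re: "norm w * c = Re w" using assms by (simp add: c_def)
  have "c\<^sup>2 \<le> 1" using c by (simp add: abs_square_le_1)
  hence "(norm w * sin (arccos c))\<^sup>2 = (norm w)\<^sup>2 - (norm w * c)\<^sup>2"
    using c by (simp add: sin_arccos_abs power_mult_distrib algebra_simps)
  also have "\<dots> = (Im w)\<^sup>2" unfolding Re by (simp add: cmod_power2)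
  finally have "norm w * sin (arccos c) = Im w \<or> norm w * sin (arccos c) = - Im w"
    by (simp only: power2_eq_iff)
  hence "of_real (norm w) * cis (arccos c) \<in> {w, cnj w}"
    using c Re by (auto simp: complex_eq_iff cos_arccos_abs)
  thus ?thesis by (auto simp: real c_def)
qed

lemma norm_less_if_Re_less:
  assumes "norm w = norm w'" "Re w < Re w'"
  shows "norm (f w) < norm (f w')"
proof -
  have nz: "w \<noteq> 0" "w' \<noteq> 0" using assms by auto
  have "-1 \<le> Re w / norm w" "Re w / norm w \<le> 1" "-1 \<le> Re w' / norm w'" "Re w' / norm w' \<le> 1"
    using nz abs_Re_le_cmod[of w] abs_Re_le_cmod[of w'] by (auto simp: divide_simps)
  moreover have "Re w / norm w < Re w' / norm w'"
    using assms nz by (simp add: divide_strict_right_mono)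
  ultimately have "norm (f (of_real (norm w) * cis (arccos (Re w / norm w))))
      < norm (f (of_real (norm w) * cis (arccos (Re w' / norm w'))))"
    using nz by (intro norm_cis_decreasing arccos_less_arccos arccos_lbound arccos_ubound)
      simp_all
  thus ?thesis using norm_f_cis_arccos[OF nz(1)] norm_f_cis_arccos[OF nz(2)] assms(1) by simp
qed

end

subsection \<open>The partial theta function\<close>

lemma triangle_Suc: "Suc n * (Suc n - 1) div 2 = n * (n - 1) div 2 + n"
proof -
  have "Suc n * (Suc n - 1) = n * (n - 1) + n * 2" by (cases n) auto
  thus ?thesis by simp
qed

text \<open>The factor 4 produces the parameter p^4 in the even part of the series; the term m, or 3
  m for odd indices, produces the argument p z^2, or p^3 z^2.\<close>

lemma triangle_double: "2 * m * (2 * m - 1) div 2 = 4 * (m * (m - 1) div 2) + m" for m :: nat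
proof (induction m)
  case (Suc m)
  have "2 * Suc m = Suc (Suc (2 * m))" by simp
  thus ?case using Suc by (simp only: triangle_Suc) simp
qed simp

lemma triangle_double_Suc: "Suc (2 * m) * (Suc (2 * m) - 1) div 2 = 4 * (m * (m - 1) div 2) + 3 * m" for m :: nat
  unfolding triangle_Suc triangle_double by simp

text \<open>The quotient of the two sides has consecutive ratios r^n (n + 1) / e, which tend to 0,
  so it decreases from some N on; the sum of its values up to N serves as C. The right side has the
  coefficients of C exp (e x).\<close>

lemma power_triangle_le:
  fixes r e :: real
  assumes "0 < r" "r < 1" "e > 0"
  obtains C where "C > 0" "\<And>n. r ^ (n * (n - 1) div 2) \<le> C * (e ^ n /\<^sub>R fact n)"
proof -
  define b where "b n = r ^ (n * (n - 1) div 2) * fact n / e ^ n" for n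
  have b0: "b n > 0" for n using assms by (simp add: b_def)
  have bS: "b (Suc n) = (r ^ n * real (Suc n) / e) * b n" for n
    unfolding b_def triangle_Suc by (simp add: power_add)
  have "(\<lambda>n. real n * r ^ n) \<longlonglongrightarrow> 0" "(\<lambda>n. r ^ n) \<longlonglongrightarrow> 0"
    using assms by (intro powser_times_n_limit_0 LIMSEQ_power_zero; simp)+
  hence "(\<lambda>n. (real n * r ^ n + r ^ n) / e) \<longlonglongrightarrow> (0 + 0) / e"
    using assms by (intro tendsto_intros) auto
  hence "(\<lambda>n. r ^ n * real (Suc n) / e) \<longlonglongrightarrow> 0" by (simp add: algebra_simps)
  hence "\<forall>\<^sub>F n in sequentially. r ^ n * real (Suc n) / e < 1" by (rule order_tendstoD) simp
  then obtain N where N: "\<And>n. n \<ge> N \<Longrightarrow> r ^ n * real (Suc n) / e < 1"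
    by (auto simp: eventually_sequentially)
  define C where "C = (\<Sum>n\<le>N. b n)"
  have le: "b n \<le> C" if "n \<le> N" for n
    unfolding C_def using b0 that by (intro member_le_sum) (auto intro: less_imp_le)
  have "b n \<le> C" for n
  proof (cases "n \<le> N")
    case False
    hence "N \<le> n" by simp
    thus ?thesis
    proof (induction n rule: dec_induct)
      case (step n)
      have "b (Suc n) \<le> 1 * b n"
        unfolding bS using N[OF step(1)] b0[of n] by (intro mult_right_mono) auto
      thus ?case using step by simp
    qed (rule le; simp)
  qed (rule le)
  hence "r ^ (n * (n - 1) div 2) \<le> C * (e ^ n /\<^sub>R fact n)" for n
    using assms by (simp add: b_def field_simps)
  moreover have "C > 0" using b0[of 0] le[of 0] by simp
  ultimately show thesis using that by blast
qed

text \<open>Termwise comparison with the series of C exp (e |z|) gives both claims.\<close>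

lemma
  fixes q :: complex
  assumes q: "0 < norm q" "norm q < 1"
  shows partial_theta_summable: "summable (\<lambda>n. norm (q ^ (n * (n - 1) div 2) * z ^ n))"
    and partial_theta_growth: "e > 0 \<Longrightarrow> \<exists>C. \<forall>z. norm (partial_theta z q) \<le> C * exp (e * norm z)"
proof -
  have *: "\<exists>C. \<forall>z. summable (\<lambda>n. norm (q ^ (n * (n - 1) div 2) * z ^ n)) \<and>
      norm (partial_theta z q) \<le> C * exp (e * norm z)" if e: "e > 0" for e
  proof -
    obtain C where C: "C > 0" "\<And>n. norm q ^ (n * (n - 1) div 2) \<le> C * (e ^ n /\<^sub>R fact n)"
      using power_triangle_le[OF q e] by blast
    have le: "norm (q ^ (n * (n - 1) div 2) * z ^ n) \<le> C * ((e * norm z) ^ n /\<^sub>R fact n)" for n z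
      using mult_right_mono[OF C(2), of "norm z ^ n" n]
      by (simp add: norm_mult norm_power power_mult_distrib mult_ac)
    have sums: "(\<lambda>n. C * ((e * norm z) ^ n /\<^sub>R fact n)) sums (C * exp (e * norm z))" for z
      by (intro sums_mult exp_converges)
    have sm: "summable (\<lambda>n. norm (q ^ (n * (n - 1) div 2) * z ^ n))" for z
      by (rule summable_comparison_test'[OF sums_summable[OF sums], of 0]) (use le in simp)
    have "norm (partial_theta z q) \<le> C * exp (e * norm z)" for z
    proof -
      have "norm (partial_theta z q) \<le> (\<Sum>n. norm (q ^ (n * (n - 1) div 2) * z ^ n))"
        unfolding partial_theta_def by (rule summable_norm[OF sm])
      also have "\<dots> \<le> C * exp (e * norm z)"
        by (rule sums_le[OF le summable_sums[OF sm] sums])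
      finally show ?thesis .
    qed
    with sm show ?thesis by blast
  qed
  show "summable (\<lambda>n. norm (q ^ (n * (n - 1) div 2) * z ^ n))" using *[of 1] by auto
  show "e > 0 \<Longrightarrow> \<exists>C. \<forall>z. norm (partial_theta z q) \<le> C * exp (e * norm z)" using * by blast
qed

lemma partial_theta_sums:
  fixes q :: complex
  assumes "0 < norm q" "norm q < 1"
  shows "(\<lambda>n. q ^ (n * (n - 1) div 2) * z ^ n) sums partial_theta z q"
  unfolding partial_theta_def
  by (rule summable_sums[OF summable_norm_cancel[OF partial_theta_summable[OF assms]]])

lemma partial_theta_0: "partial_theta 0 q = 1"
  using powser_sums_zero[of "\<lambda>n. q ^ (n * (n - 1) div 2)"]
  by (simp add: partial_theta_def sums_iff)

lemma partial_theta_has_field_derivative: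
  fixes q :: complex
  assumes "0 < norm q" "norm q < 1"
  shows "((\<lambda>z. partial_theta z q) has_field_derivative
    (\<Sum>n. diffs (\<lambda>n. q ^ (n * (n - 1) div 2)) n * z ^ n)) (at z)"
  unfolding partial_theta_def
  by (rule termdiffs_strong_converges_everywhere) (rule sums_summable[OF partial_theta_sums[OF assms]])

lemma partial_theta_holomorphic:
  fixes q :: complex
  assumes "0 < norm q" "norm q < 1"
  shows "(\<lambda>z. partial_theta z q) holomorphic_on A"
  by (rule holomorphic_on_subset[of _ UNIV])
    (use partial_theta_has_field_derivative[OF assms] in \<open>auto simp: holomorphic_on_open\<close>)

text \<open>The coefficient of z is q^0 = 1, so the derivative at 0 does not vanish.\<close>

lemma partial_theta_nonconstant:
  fixes q :: complex
  assumes "0 < norm q" "norm q < 1"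
  shows "\<exists>z. partial_theta z q \<noteq> 1"
proof (rule ccontr)
  assume "\<not> ?thesis"
  hence "(\<lambda>z. partial_theta z q) = (\<lambda>_. 1)" by auto
  hence "((\<lambda>z. partial_theta z q) has_field_derivative 0) (at 0)" by simp
  from DERIV_unique[OF partial_theta_has_field_derivative[OF assms] this]
  show False
    using powser_sums_zero[of "diffs (\<lambda>n. q ^ (n * (n - 1) div 2))"] by (simp add: sums_iff diffs_def)
qed

lemma partial_theta_cnj:
  assumes "0 < norm q" "norm q < 1"
  shows "partial_theta (cnj z) (cnj q) = cnj (partial_theta z q)"
proof -
  have "(\<lambda>n. cnj (q ^ (n * (n - 1) div 2) * z ^ n)) sums cnj (partial_theta z q)"
    by (subst sums_cnj) (rule partial_theta_sums[OF assms])
  thus ?thesis by (simp add: partial_theta_def sums_iff)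
qed

lemma partial_theta_even_odd:
  fixes p :: complex
  assumes p: "0 < norm p" "norm p < 1"
  shows "partial_theta z p = partial_theta (p * z\<^sup>2) (p ^ 4) + z * partial_theta (p ^ 3 * z\<^sup>2) (p ^ 4)"
proof -
  have p4: "0 < norm (p ^ 4)" "norm (p ^ 4) < 1"
    using p by (simp_all add: norm_power power_less_one_iff)
  let ?e = "\<lambda>m. (p ^ 4) ^ (m * (m - 1) div 2) * (p * z\<^sup>2) ^ m"
  let ?o = "\<lambda>m. z * ((p ^ 4) ^ (m * (m - 1) div 2) * (p ^ 3 * z\<^sup>2) ^ m)"
  let ?t = "\<lambda>n. p ^ (n * (n - 1) div 2) * z ^ n"
  have "(\<lambda>m. sum ?t {m * 2..<m * 2 + 2}) sums partial_theta z p"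
    by (rule sums_group[OF partial_theta_sums[OF p]]) simp
  moreover have "sum ?t {m * 2..<m * 2 + 2} = ?e m + ?o m" for m
  proof -
    have "{m * 2..<m * 2 + 2} = {2 * m, Suc (2 * m)}" by auto
    hence "sum ?t {m * 2..<m * 2 + 2} = ?t (2 * m) + ?t (Suc (2 * m))" by simp
    moreover have "?t (2 * m) = ?e m" unfolding triangle_double
      by (simp add: power_add power_mult power_mult_distrib)
    moreover have "?t (Suc (2 * m)) = ?o m" unfolding triangle_double_Suc
      by (simp add: power_add power_mult power_mult_distrib)
    ultimately show ?thesis by simp
  qed
  ultimately have "(\<lambda>m. ?e m + ?o m) sums partial_theta z p" by simp
  moreover have "(\<lambda>m. ?e m + ?o m) sums
      (partial_theta (p * z\<^sup>2) (p ^ 4) + z * partial_theta (p ^ 3 * z\<^sup>2) (p ^ 4))"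
    by (intro sums_add sums_mult partial_theta_sums[OF p4])
  ultimately show ?thesis by (rule sums_unique2)
qed

lemma real_entire_negative_zeros_partial_theta:
  assumes r: "0 < r" "r < 1" and neg: "only_negative_zeros r"
  shows "real_entire_negative_zeros (\<lambda>z. partial_theta z (of_real r))"
proof -
  have r': "0 < norm (of_real r :: complex)" "norm (of_real r :: complex) < 1" using r by auto
  show ?thesis
    using neg partial_theta_growth[OF r'] partial_theta_nonconstant[OF r']
      partial_theta_cnj[OF r'] partial_theta_holomorphic[OF r']
    by unfold_locales (auto simp: only_negative_zeros_def partial_theta_0)
qed

section \<open>Zeros of the partial theta function with imaginary parameter\<close>

theorem mainTheorem12:
  fixes q qt :: real and p :: complex
  assumes "is_q_tilde qt"
    and "0 < q" and "q \<le> qt powr (1/4)"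
    and "p = \<i> * complex_of_real q \<or> p = - \<i> * complex_of_real q"
  shows "(\<forall>z. partial_theta z p = 0 \<longrightarrow> zorder (\<lambda>w. partial_theta w p) z = 1) \<and>
         (\<forall>z w. partial_theta z p = 0 \<and> partial_theta w p = 0 \<and> z \<noteq> w \<longrightarrow> norm z \<noteq> norm w)"
proof -
  have qt: "0 < qt" "qt < 1" and qt_neg: "\<And>r. 0 < r \<Longrightarrow> r \<le> qt \<Longrightarrow> only_negative_zeros r"
    using assms(1) by (auto simp: is_q_tilde_def negative_zeros_bounds_def)
  \<comment> \<open>The fourth root in the hypothesis is what places the parameter q^4 of the even
    and odd parts in the range of only negative zeros.\<close>
  have "q ^ 4 \<le> (qt powr (1/4)) ^ 4" using assms(2,3) by (intro power_mono) auto
  also have "\<dots> = qt" using qt by (simp add: powr_power)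
  finally have q4: "0 < q ^ 4" "q ^ 4 \<le> qt" using assms(2) by auto
  have q1: "q < 1" using q4 qt one_le_power[of q 4] by linarith
  have np: "norm p = q" using assms(2,4) by (auto simp: norm_mult)
  have p2: "p\<^sup>2 = - of_real (q\<^sup>2)" using assms(4) by (auto simp: power_mult_distrib)
  have cp: "cnj p = - p" using assms(4) by auto
  have p0: "p \<noteq> 0" using np assms(2) by auto
  have p4: "p ^ 4 = of_real (q ^ 4)"
  proof -
    have "p ^ 4 = (p\<^sup>2)\<^sup>2" by (simp flip: power_mult)
    thus ?thesis unfolding p2 by (simp flip: power_mult)
  qed
  define f where "f z = partial_theta z (of_real (q ^ 4))" for z
  interpret real_entire_negative_zeros f
    unfolding f_def using q4 qt by (intro real_entire_negative_zeros_partial_theta qt_neg) auto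
  \<comment> \<open>This is p^3, written so that c z^2 is visibly a negative multiple of v = p
    z^2.\<close>
  define c where "c = - of_real (q\<^sup>2) * p"
  have theta: "partial_theta z p = f (p * z\<^sup>2) + z * f (c * z\<^sup>2)" for z
  proof -
    have "p ^ 3 = c" by (simp only: c_def flip: p2) (simp add: power2_eq_square power3_eq_cube)
    thus ?thesis using partial_theta_even_odd[of p z] np assms(2) q1
      by (simp only: p4 f_def)
  qed
  have cv: "c * z\<^sup>2 = - of_real (q\<^sup>2) * (p * z\<^sup>2)" for z by (simp add: c_def)
  have zero: "z \<noteq> 0 \<and> f (p * z\<^sup>2) \<noteq> 0 \<and> f (c * z\<^sup>2) \<noteq> 0 \<and> z = - f (p * z\<^sup>2) / f (c * z\<^sup>2)"
    if z: "partial_theta z p = 0" for z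
  proof -
    have z0: "z \<noteq> 0" using z f_0 by (auto simp: theta)
    \<comment> \<open>If one value vanishes, the equation makes the other vanish too. Then v and
      -q^2 v would both be negative.\<close>
    have "f (p * z\<^sup>2) \<noteq> 0 \<and> f (c * z\<^sup>2) \<noteq> 0"
    proof (rule ccontr)
      assume "\<not> ?thesis"
      hence 0: "f (p * z\<^sup>2) = 0" "f (c * z\<^sup>2) = 0" using z z0 by (auto simp: theta)
      from zeros[OF 0(1)] zeros[OF 0(2)] have "Re (p * z\<^sup>2) < 0" "- (q\<^sup>2 * Re (p * z\<^sup>2)) < 0"
        unfolding cv by auto
      thus False using mult_pos_neg[of "q\<^sup>2" "Re (p * z\<^sup>2)"] assms(2) by auto
    qed
    thus ?thesis using z z0 by (auto simp: theta field_simps add_eq_0_iff)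
  qed
  \<comment> \<open>For real v both values of f are real, hence so is z. But then p z^2 is imaginary
    as well as real, so z = 0.\<close>
  have Im_nz: "Im (p * z\<^sup>2) \<noteq> 0" if z: "partial_theta z p = 0" for z
  proof
    assume Im: "Im (p * z\<^sup>2) = 0"
    hence v: "cnj (p * z\<^sup>2) = p * z\<^sup>2" by (metis Reals_cnj_iff complex_is_Real_iff)
    hence u: "cnj (c * z\<^sup>2) = c * z\<^sup>2" unfolding cv by simp
    have "cnj z = - cnj (f (p * z\<^sup>2)) / cnj (f (c * z\<^sup>2))"
      using arg_cong[OF conjunct2[OF conjunct2[OF conjunct2[OF zero[OF z]]]], of cnj] by simp
    also have "\<dots> = z" unfolding real[symmetric] u v using zero[OF z] by simp
    finally have "cnj z = z" .
    hence "p * z\<^sup>2 = - (p * z\<^sup>2)" using v cp by simp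
    thus False using p0 zero[OF z] by simp
  qed

  have hol_theta: "(\<lambda>w. partial_theta w p) holomorphic_on UNIV"
    using np assms(2) q1 by (intro partial_theta_holomorphic) auto
  have simple: "zorder (\<lambda>w. partial_theta w p) z = 1" if z: "partial_theta z p = 0" for z
  proof -
    define v u where "v = p * z\<^sup>2" and "u = c * z\<^sup>2"
    have nz: "z \<noteq> 0" "f v \<noteq> 0" "f u \<noteq> 0" and eq: "z * f u = - f v"
      using zero[OF z] z by (auto simp: v_def u_def theta add_eq_0_iff2)
    have df: "(f has_field_derivative deriv f w) (at w)" for w
      by (rule holomorphic_derivI[OF hol open_UNIV]) auto
    have "((\<lambda>w. f (p * w\<^sup>2) + w * f (c * w\<^sup>2)) has_field_derivative
        deriv f v * (2 * p * z) + (f u + z * (deriv f u * (2 * c * z)))) (at z)"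
      unfolding u_def v_def
      by (rule derivative_eq_intros DERIV_chain2[OF df] refl)+ (simp add: algebra_simps)
    hence D: "deriv (\<lambda>w. partial_theta w p) z =
        deriv f v * (2 * p * z) + (f u + z * (deriv f u * (2 * c * z)))"
      unfolding theta by (rule DERIV_imp_deriv)
    have "deriv (\<lambda>w. partial_theta w p) z \<noteq> 0"
    proof
      assume "deriv (\<lambda>w. partial_theta w p) z = 0"
      \<comment> \<open>Multiplying by z produces v f'(v) and u f'(u). Substituting z = - f(v) /
        f(u) and dividing by f(v) leaves 2 v f'(v)/f(v) - 1 = 2 u f'(u)/f(u), and the real constant
        drops out of the imaginary parts.\<close>
      hence "z * (deriv f v * (2 * p * z) + (f u + z * (deriv f u * (2 * c * z)))) = 0"
        unfolding D by simp
      hence "2 * (v * deriv f v) + z * f u + 2 * z * (u * deriv f u) = 0"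
        by (simp add: v_def u_def algebra_simps power2_eq_square)
      moreover have "z = - f v / f u" using eq nz by (simp add: field_simps)
      ultimately have "2 * (v * deriv f v / f v) - 1 = 2 * (u * deriv f u / f u)"
        using nz by (simp add: field_simps)
      moreover have "Im a = Im b" if "2 * a - 1 = 2 * b" for a b
        using arg_cong[OF that, of Im] by simp
      ultimately have L: "Im (v * deriv f v / f v) = Im (u * deriv f u / f u)" by blast
      have Imv: "Im v \<noteq> 0" using Im_nz[OF z] by (simp add: v_def)
      have Imu: "Im u = - (q\<^sup>2 * Im v)" unfolding u_def v_def cv by simp
      have "Im v * Im (v * deriv f v / f v) > 0" by (rule Im_log_derivative[OF Imv])
      moreover have "Im u * Im (u * deriv f u / f u) > 0"
        using Imu Imv assms(2) by (intro Im_log_derivative) auto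
      ultimately show False
        using assms(2) unfolding Imu L by (auto simp: zero_less_mult_iff mult_less_0_iff)
    qed
    thus ?thesis
      using z by (intro zorder_zero_eqI[OF hol_theta open_UNIV]) auto
  qed

  have inj: "z = w" if z: "partial_theta z p = 0" and w: "partial_theta w p = 0"
    and n: "norm z = norm w" for z w
  proof -
    \<comment> \<open>A smaller Re v makes |f(v)| smaller and, as u = -q^2 v reverses the order,
      |f(u)| larger. Both effects make |z| = |f(v)| / |f(u)| smaller. The claim is applied in both
      directions.\<close>
    have not_less: "\<not> Re (p * z\<^sup>2) < Re (p * w\<^sup>2)"
      if z: "partial_theta z p = 0" and w: "partial_theta w p = 0" and n: "norm z = norm w" for z w
    proof
      assume less: "Re (p * z\<^sup>2) < Re (p * w\<^sup>2)"
      have 1: "norm (f (p * z\<^sup>2)) < norm (f (p * w\<^sup>2))"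
        using n less by (intro norm_less_if_Re_less) (auto simp: norm_mult norm_power)
      have 2: "norm (f (c * w\<^sup>2)) < norm (f (c * z\<^sup>2))"
      proof (rule norm_less_if_Re_less)
        show "norm (c * w\<^sup>2) = norm (c * z\<^sup>2)" using n by (simp add: norm_mult norm_power)
        have "q\<^sup>2 * Re (p * z\<^sup>2) < q\<^sup>2 * Re (p * w\<^sup>2)"
          using less assms(2) by (intro mult_strict_left_mono) auto
        thus "Re (c * w\<^sup>2) < Re (c * z\<^sup>2)" unfolding cv by simp
      qed
      have "norm (f (p * z\<^sup>2)) / norm (f (c * z\<^sup>2)) < norm (f (p * w\<^sup>2)) / norm (f (c * w\<^sup>2))"
        using 1 2 zero[OF w] by (intro frac_less) auto
      moreover have "norm z = norm (f (p * z\<^sup>2)) / norm (f (c * z\<^sup>2))"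
        "norm w = norm (f (p * w\<^sup>2)) / norm (f (c * w\<^sup>2))"
        using zero[OF z] zero[OF w] by (metis norm_divide norm_minus_cancel)+
      ultimately show False using n by simp
    qed
    have Re: "Re (p * z\<^sup>2) = Re (p * w\<^sup>2)"
      using not_less[OF z w n] not_less[OF w z] n by simp
    have "norm (p * z\<^sup>2) = norm (p * w\<^sup>2)" using n by (simp add: norm_mult norm_power)
    hence "(Re (p * z\<^sup>2))\<^sup>2 + (Im (p * z\<^sup>2))\<^sup>2 = (Re (p * w\<^sup>2))\<^sup>2 + (Im (p * w\<^sup>2))\<^sup>2"
      by (simp only: flip: cmod_power2)
    hence "(Im (p * z\<^sup>2))\<^sup>2 = (Im (p * w\<^sup>2))\<^sup>2" unfolding Re by simp
    hence "Im (p * z\<^sup>2) = Im (p * w\<^sup>2) \<or> Im (p * z\<^sup>2) = - Im (p * w\<^sup>2)"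
      by (simp only: power2_eq_iff)
    hence "p * z\<^sup>2 = p * w\<^sup>2 \<or> p * z\<^sup>2 = cnj (p * w\<^sup>2)"
      unfolding complex_eq_iff cnj.sel using Re by blast
    thus "z = w"
    proof
      assume "p * z\<^sup>2 = p * w\<^sup>2"
      moreover from this have "c * z\<^sup>2 = c * w\<^sup>2" unfolding cv by simp
      ultimately show ?thesis using zero[OF z] zero[OF w] by metis
    next
      \<comment> \<open>Here z is the conjugate of w. Since conjugation negates p, the assumption
        becomes p z^2 = - p z^2, which is impossible for nonzero z.\<close>
      assume v: "p * z\<^sup>2 = cnj (p * w\<^sup>2)"
      hence u: "c * z\<^sup>2 = cnj (c * w\<^sup>2)" unfolding cv by simp
      have "z = - f (p * z\<^sup>2) / f (c * z\<^sup>2)" using zero[OF z] by blast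
      also have "\<dots> = cnj (- f (p * w\<^sup>2) / f (c * w\<^sup>2))" unfolding u v real by simp
      also have "- f (p * w\<^sup>2) / f (c * w\<^sup>2) = w" using zero[OF w] by simp
      finally have "z = cnj w" .
      hence "p * z\<^sup>2 = - (p * z\<^sup>2)" using v cp by simp
      thus ?thesis using p0 zero[OF z] by simp
    qed
  qed
  show ?thesis using simple inj by blast
qed

end
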